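(* The image subspace of a continuous closure operator on a quasisober space (respectively cut space, weakly sober space) is not always quasisober (respectively a cut space, weakly sober). That is: (i) there exist a quasisober space $X$ and a continuous map $p:X\to X$ that is a closure operator for the specialization order of $X$ such that the subspace $p(X)$ of $X$ is not quasisober; (ii) the same with "quasisober" replaced in both places by "cut space"; (iii) the same with "quasisober" replaced in both places by "weakly sober".
   Context: For a topological space $X$, the specialization preorder is $x\le y$ iff $x\in\mathrm{cl}\{y\}$; all order-theoretic notions in $X$ refer to it (for a subspace, to the specialization preorder of the subspace, with bounds taken inside the subspace). For $A\subseteq X$, $A^{\uparrow}$ and $A^{\downarrow}$ denote the sets of all upper, respectively lower, bounds of $A$ in $X$, and $A^{\delta}=(A^{\uparrow})^{\downarrow}$ is the cut closure of $A$; $A$ is a cut if $A=A^{\delta}$. Directed sets and irreducible closed sets are nonempty. $X$ is a cut space if $\mathrm{cl}\,D=D^{\delta}$ for every directed subset $D$ of $X$. $X$ is weakly sober if it is $T_0$ and every irreducible closed subset $A$ of $X$ is a cut. $X$ is quasisober if it is $T_0$ and every irreducible closed subset of $X$ equals $D^{\delta}$ for some directed subset $D$ of $X$. A closure operator is a monotone idempotent self-map $p$ with $x\le p(x)$ for all $x$. *)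

theory Defs
  imports "HOL-Analysis.Analysis"
begin

definition spec_le :: "'a topology \<Rightarrow> 'a \<Rightarrow> 'a \<Rightarrow> bool" where
  "spec_le X x y \<longleftrightarrow> x \<in> topspace X \<and> y \<in> topspace X \<and> x \<in> X closure_of {y}"

definition upper_bounds :: "'a topology \<Rightarrow> 'a set \<Rightarrow> 'a set" where
  "upper_bounds X A = {u \<in> topspace X. \<forall>a\<in>A. spec_le X a u}"

definition lower_bounds :: "'a topology \<Rightarrow> 'a set \<Rightarrow> 'a set" where
  "lower_bounds X A = {l \<in> topspace X. \<forall>a\<in>A. spec_le X l a}"

definition cut_closure :: "'a topology \<Rightarrow> 'a set \<Rightarrow> 'a set" where
  "cut_closure X A = lower_bounds X (upper_bounds X A)"

definition is_cut :: "'a topology \<Rightarrow> 'a set \<Rightarrow> bool" where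
  "is_cut X A \<longleftrightarrow> A \<subseteq> topspace X \<and> A = cut_closure X A"

definition directed_in :: "'a topology \<Rightarrow> 'a set \<Rightarrow> bool" where
  "directed_in X D \<longleftrightarrow> D \<subseteq> topspace X \<and> D \<noteq> {} \<and>
     (\<forall>x\<in>D. \<forall>y\<in>D. \<exists>z\<in>D. spec_le X x z \<and> spec_le X y z)"

definition irreducible_closed :: "'a topology \<Rightarrow> 'a set \<Rightarrow> bool" where
  "irreducible_closed X A \<longleftrightarrow> closedin X A \<and> A \<noteq> {} \<and>
     (\<forall>B C. closedin X B \<and> closedin X C \<and> A = B \<union> C \<longrightarrow> A = B \<or> A = C)"

text \<open>Unlike the two notions that follow it, a cut space is not required to be T0.\<close>

definition cut_space :: "'a topology \<Rightarrow> bool" where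
  "cut_space X \<longleftrightarrow> (\<forall>D. directed_in X D \<longrightarrow> X closure_of D = cut_closure X D)"

definition weakly_sober :: "'a topology \<Rightarrow> bool" where
  "weakly_sober X \<longleftrightarrow> t0_space X \<and> (\<forall>A. irreducible_closed X A \<longrightarrow> is_cut X A)"

definition quasisober :: "'a topology \<Rightarrow> bool" where
  "quasisober X \<longleftrightarrow> t0_space X \<and>
     (\<forall>A. irreducible_closed X A \<longrightarrow> (\<exists>D. directed_in X D \<and> A = cut_closure X D))"

text \<open>Only the values of \<open>p\<close> on \<open>topspace X\<close> matter.\<close>

definition closure_operator :: "'a topology \<Rightarrow> ('a \<Rightarrow> 'a) \<Rightarrow> bool" where
  "closure_operator X p \<longleftrightarrow>
     p \<in> topspace X \<rightarrow> topspace X \<and>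
     (\<forall>x\<in>topspace X. \<forall>y\<in>topspace X. spec_le X x y \<longrightarrow> spec_le X (p x) (p y)) \<and>
     (\<forall>x\<in>topspace X. p (p x) = p x) \<and>
     (\<forall>x\<in>topspace X. spec_le X x (p x))"

definition image_subspace :: "'a topology \<Rightarrow> ('a \<Rightarrow> 'a) \<Rightarrow> 'a topology" where
  "image_subspace X p = subtopology X (p ` topspace X)"

end

(* Let X be an infinite chain C together with two incomparable upper bounds a, b of C and a
   greatest element c, with the topology whose closed sets are all lower sets. The chain C is
   the set of common lower bounds of a and b, hence a cut. The closure operator p that fixes C
   and sends a, b to c removes these two witnesses: in p(X) = C + {c} the set C is still closed
   and irreducible, but its only upper bound is c, so C is not the set of lower bounds of
   anything. *)

theory Submission
  imports Defs
begin

section \<open>Alexandrov topologies and their specialization order\<close>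

definition alexandrov :: "('a \<Rightarrow> 'a \<Rightarrow> bool) \<Rightarrow> 'a topology" where
  "alexandrov r = topology (\<lambda>U. \<forall>x\<in>U. \<forall>y. r x y \<longrightarrow> y \<in> U)"

lemma openin_alexandrov: "openin (alexandrov r) U \<longleftrightarrow> (\<forall>x\<in>U. \<forall>y. r x y \<longrightarrow> y \<in> U)"
proof -
  have "istopology (\<lambda>U. \<forall>x\<in>U. \<forall>y. r x y \<longrightarrow> y \<in> U)"
    unfolding istopology_def by blast
  then show ?thesis
    unfolding alexandrov_def by (simp add: topology_inverse')
qed

lemma topspace_alexandrov [simp]: "topspace (alexandrov r) = UNIV"
  using openin_subset[of "alexandrov r" UNIV] by (auto simp: openin_alexandrov)

lemma closedin_alexandrov: "closedin (alexandrov r) A \<longleftrightarrow> (\<forall>y\<in>A. \<forall>x. r x y \<longrightarrow> x \<in> A)"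
  unfolding closedin_def openin_alexandrov by auto

lemma closure_of_alexandrov:
  assumes "reflp r" "transp r"
  shows "alexandrov r closure_of S = {x. \<exists>y\<in>S. r x y}"
proof (rule closure_of_unique)
  show "S \<subseteq> {x. \<exists>y\<in>S. r x y}"
    using assms(1) by (auto dest: reflpD)
  show "closedin (alexandrov r) {x. \<exists>y\<in>S. r x y}"
    using assms(2) by (auto simp: closedin_alexandrov dest: transpD)
qed (auto simp: closedin_alexandrov)

lemma spec_le_alexandrov:
  assumes "reflp r" "transp r"
  shows "spec_le (alexandrov r) x y \<longleftrightarrow> r x y"
  by (simp add: spec_le_def closure_of_alexandrov[OF assms])

lemma t0_space_alexandrov:
  assumes "reflp r" "transp r" "antisymp r"
  shows "t0_space (alexandrov r)"
  unfolding t0_space_def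
proof (intro ballI impI)
  fix x y :: 'a assume "x \<noteq> y"
  then have "\<not> r x y \<or> \<not> r y x"
    using assms(3) by (auto dest: antisympD)
  moreover have "openin (alexandrov r) {z. r w z}" "w \<in> {z. r w z}" for w
    using assms by (auto simp: openin_alexandrov dest: transpD reflpD)
  ultimately show "\<exists>U. openin (alexandrov r) U \<and> (x \<notin> U) = (y \<in> U)"
    by (metis mem_Collect_eq)
qed

lemma continuous_map_alexandrov:
  assumes "\<And>x y. r x y \<Longrightarrow> s (f x) (f y)"
  shows "continuous_map (alexandrov r) (alexandrov s) f"
  using assms by (auto simp: continuous_map openin_alexandrov)

text \<open>If \<open>x\<close> and \<open>y\<close> had no common upper bound in \<open>A\<close>,
  then \<open>A\<close> would split into its points not above \<open>x\<close> and its points not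
  above \<open>y\<close>. Both pieces are lower sets, hence closed, and each misses a point of
  \<open>A\<close>.\<close>

lemma directed_in_irreducible_closed_alexandrov:
  assumes "reflp r" "transp r" and A: "irreducible_closed (alexandrov r) A"
  shows "directed_in (alexandrov r) A"
proof -
  have "\<exists>z\<in>A. r x z \<and> r y z" if "x \<in> A" "y \<in> A" for x y
  proof (rule ccontr)
    assume "\<not> ?thesis"
    then have "A = {z \<in> A. \<not> r x z} \<union> {z \<in> A. \<not> r y z}"
      by auto
    moreover have "closedin (alexandrov r) {z \<in> A. \<not> r w z}" for w
      using A assms(2) by (auto simp: irreducible_closed_def closedin_alexandrov dest: transpD)
    ultimately have "A = {z \<in> A. \<not> r x z} \<or> A = {z \<in> A. \<not> r y z}"
      using A unfolding irreducible_closed_def by blast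
    then show False
      using that reflpD[OF assms(1)] by blast
  qed
  then show ?thesis
    using A by (auto simp: directed_in_def irreducible_closed_def spec_le_alexandrov[OF assms(1,2)])
qed

text \<open>If closed sets \<open>B\<close> and \<open>C\<close> cover \<open>D\<close> but neither
  contains it, some \<open>z\<close> in \<open>D\<close> lies above a point outside \<open>B\<close>
  and a point outside \<open>C\<close>. Since closed sets are lower sets, \<open>z\<close> is then
  in neither.\<close>

lemma irreducible_closed_closure_of_directed:
  assumes D: "directed_in X D"
  shows "irreducible_closed X (X closure_of D)"
  unfolding irreducible_closed_def
proof (intro conjI allI impI)
  have sub: "D \<subseteq> X closure_of D"
    using D by (simp add: directed_in_def closure_of_subset)
  then show "X closure_of D \<noteq> {}"
    using D by (auto simp: directed_in_def)
  fix B C assume BC: "closedin X B \<and> closedin X C \<and> X closure_of D = B \<union> C"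
  have "D \<subseteq> B \<or> D \<subseteq> C"
  proof (rule ccontr)
    assume "\<not> ?thesis"
    then obtain x y where xy: "x \<in> D" "x \<notin> B" "y \<in> D" "y \<notin> C"
      by blast
    then obtain z where z: "z \<in> D" "x \<in> X closure_of {z}" "y \<in> X closure_of {z}"
      using D unfolding directed_in_def spec_le_def by metis
    then have "z \<in> B \<or> z \<in> C"
      using sub BC by blast
    then have "X closure_of {z} \<subseteq> B \<or> X closure_of {z} \<subseteq> C"
      using BC by (meson closure_of_minimal empty_subsetI insert_subset)
    then show False
      using xy z by blast
  qed
  then show "X closure_of D = B \<or> X closure_of D = C"
    using BC closure_of_minimal[of D _ X] by blast
qed simp

text \<open>Such a \<open>D\<close> is irreducible and its own closure, so each of the three
  properties would present it as a cut closure. One set thus refutes all three.\<close>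

lemma not_sober_like_if_not_cut_closure:
  assumes D: "directed_in Y D" "closedin Y D" and not_cut: "\<And>E. cut_closure Y E \<noteq> D"
  shows "\<not> quasisober Y" "\<not> cut_space Y" "\<not> weakly_sober Y"
proof -
  have cl: "Y closure_of D = D"
    using D by (simp add: closure_of_closedin)
  then have "irreducible_closed Y D"
    using irreducible_closed_closure_of_directed[OF D(1)] by simp
  then show "\<not> quasisober Y" "\<not> weakly_sober Y"
    using not_cut unfolding quasisober_def weakly_sober_def is_cut_def by metis+
  show "\<not> cut_space Y"
    using D(1) cl not_cut by (metis cut_space_def)
qed

text \<open>Here irreducible closed sets are directed and equal to their closure, so the cut space
  condition turns each of them into its own cut closure.\<close>

lemma sober_like_alexandrov_if_cut_space:
  assumes r: "reflp r" "transp r" "antisymp r" and cut: "cut_space (alexandrov r)"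
  shows "quasisober (alexandrov r)" "weakly_sober (alexandrov r)"
proof -
  have "directed_in (alexandrov r) A \<and> A = cut_closure (alexandrov r) A"
    if A: "irreducible_closed (alexandrov r) A" for A
  proof -
    have "alexandrov r closure_of A = A"
      using A by (simp add: irreducible_closed_def closure_of_closedin)
    then show ?thesis
      using directed_in_irreducible_closed_alexandrov[OF r(1,2) A] cut
      by (auto simp: cut_space_def)
  qed
  then show "quasisober (alexandrov r)" "weakly_sober (alexandrov r)"
    using t0_space_alexandrov[OF r]
    by (auto simp: quasisober_def weakly_sober_def is_cut_def)
qed

section \<open>The fork and its closure operator\<close>

text \<open>The numbers from 3 on form the chain \<open>C\<close>; 0 and 1 are \<open>a\<close> and \<open>b\<close>, and 2 is \<open>c\<close>.\<close>

definition fork_le :: "nat \<Rightarrow> nat \<Rightarrow> bool" where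
  "fork_le x y \<longleftrightarrow> x = y \<or> y = 2 \<or> (3 \<le> x \<and> (y < 2 \<or> x \<le> y))"

definition fork_closure :: "nat \<Rightarrow> nat" where
  "fork_closure x = (if x < 3 then 2 else x)"

lemma fork_le_order: "reflp fork_le" "transp fork_le" "antisymp fork_le"
proof -
  show "reflp fork_le"
    by (simp add: reflp_def fork_le_def)
  show "transp fork_le"
    by (rule transpI) (unfold fork_le_def, presburger)
  show "antisymp fork_le"
    by (rule antisympI) (unfold fork_le_def, presburger)
qed

lemmas spec_le_fork = spec_le_alexandrov[OF fork_le_order(1,2)]
  and closure_of_fork = closure_of_alexandrov[OF fork_le_order(1,2)]

lemma range_fork_closure: "range fork_closure = {2..}"
proof -
  have "x \<in> range fork_closure" if "2 \<le> x" for x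
    using that by (intro range_eqI[of _ _ x]) (auto simp: fork_closure_def)
  then show ?thesis
    by (auto simp: fork_closure_def)
qed

lemma fork_closure_mono: "fork_le x y \<Longrightarrow> fork_le (fork_closure x) (fork_closure y)"
  unfolding fork_le_def fork_closure_def by presburger

lemma closure_operator_fork_closure: "closure_operator (alexandrov fork_le) fork_closure"
proof -
  have "fork_closure (fork_closure x) = fork_closure x" "fork_le x (fork_closure x)" for x
    by (auto simp: fork_closure_def fork_le_def)
  then show ?thesis
    by (simp add: closure_operator_def spec_le_fork fork_closure_mono)
qed

lemma cut_space_fork: "cut_space (alexandrov fork_le)"
  unfolding cut_space_def
proof (intro allI impI)
  fix D assume D: "directed_in (alexandrov fork_le) D"
  then have ne: "D \<noteq> {}" and dir: "\<And>x y. x \<in> D \<Longrightarrow> y \<in> D \<Longrightarrow> \<exists>z\<in>D. fork_le x z \<and> fork_le y z"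
    by (auto simp: directed_in_def spec_le_fork)
  \<comment> \<open>The nontrivial inclusion, contrapositively: a point outside the closure of
    \<open>D\<close> fails to lie below some upper bound of \<open>D\<close>.\<close>
  have "\<exists>u. (\<forall>d\<in>D. fork_le d u) \<and> \<not> fork_le x u" if x: "\<forall>d\<in>D. \<not> fork_le x d" for x
  proof -
    have max: ?thesis if "m \<in> D" "\<forall>d\<in>D. fork_le d m" for m
      using that x by blast
    consider "2 \<in> D" | i where "i \<in> D" "i < 2" "2 \<notin> D" | "D \<subseteq> {3..}"
    proof -
      assume a: "2 \<in> D \<Longrightarrow> thesis" "\<And>i. i \<in> D \<Longrightarrow> i < 2 \<Longrightarrow> 2 \<notin> D \<Longrightarrow> thesis"
        "D \<subseteq> {3..} \<Longrightarrow> thesis"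
      have "i < 2 \<or> i = 2" if "\<not> 3 \<le> i" for i :: nat
        using that by linarith
      then show thesis
        using a by (metis atLeast_iff subsetI)
    qed
    then show ?thesis
    proof cases
      case 1
      then show ?thesis
        by (rule max) (simp add: fork_le_def)
    next
      case (2 i)
      \<comment> \<open>Only \<open>i\<close> and \<open>2\<close> lie above \<open>i\<close>, and
        \<open>2\<close> is not in \<open>D\<close>, so directedness makes \<open>i\<close> the
        greatest element of \<open>D\<close>.\<close>
      have "fork_le d i" if "d \<in> D" for d
      proof -
        obtain z where "z \<in> D" "fork_le d z" "fork_le i z"
          using dir \<open>i \<in> D\<close> \<open>d \<in> D\<close> by blast
        moreover from this 2 have "z = i"
          by (auto simp: fork_le_def)
        ultimately show ?thesis
          by simp
      qed
      with \<open>i \<in> D\<close> show ?thesis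
        by (auto intro: max)
    next
      case 3
      show ?thesis
      proof (cases "x < 3")
        case True
        \<comment> \<open>Both prongs bound the chain, and none of \<open>0\<close>,
          \<open>1\<close>, \<open>2\<close> lies below both of them.\<close>
        have "\<forall>d\<in>D. fork_le d 0" "\<forall>d\<in>D. fork_le d 1"
          using 3 by (auto simp: fork_le_def)
        moreover have "\<not> fork_le x 0 \<or> \<not> fork_le x 1"
          using True by (auto simp: fork_le_def)
        ultimately show ?thesis
          by blast
      next
        case False
        then have lt: "d < x" if "d \<in> D" for d
          using x that by (force simp: fork_le_def)
        obtain e where "e \<in> D"
          using ne by blast
        \<comment> \<open>This keeps \<open>x - 1\<close> inside the chain; the predecessor of
          \<open>3\<close> would be the top element \<open>2\<close>.\<close>
        with lt 3 have "4 \<le> x"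
          by force
        then have "\<not> fork_le x (x - 1)"
          by (auto simp: fork_le_def)
        moreover have "fork_le d (x - 1)" if "d \<in> D" for d
          using lt[OF that] 3 that by (auto simp: fork_le_def)
        ultimately show ?thesis
          by blast
      qed
    qed
  qed
  moreover have "fork_le x u" if "d \<in> D" "fork_le x d" "\<forall>d\<in>D. fork_le d u" for x d u
    using that fork_le_order(2) by (blast dest: transpD)
  ultimately have "(\<exists>d\<in>D. fork_le x d) \<longleftrightarrow> (\<forall>u. (\<forall>d\<in>D. fork_le d u) \<longrightarrow> fork_le x u)" for x
    by blast
  then show "alexandrov fork_le closure_of D = cut_closure (alexandrov fork_le) D"
    by (simp add: cut_closure_def lower_bounds_def upper_bounds_def closure_of_fork spec_le_fork)
qed

section \<open>The chain in the image subspace\<close>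

lemma spec_le_fork_image:
  "spec_le (image_subspace (alexandrov fork_le) fork_closure) x y \<longleftrightarrow> 2 \<le> x \<and> 2 \<le> y \<and> fork_le x y"
  by (auto simp: spec_le_def image_subspace_def range_fork_closure closure_of_subtopology
      closure_of_fork)

lemma topspace_fork_image [simp]:
  "topspace (image_subspace (alexandrov fork_le) fork_closure) = {2..}"
  by (simp add: image_subspace_def range_fork_closure)

text \<open>An upper bound \<open>n\<close> of \<open>E\<close> in the chain excludes
  \<open>Suc n\<close> from the cut closure; without such a bound the cut closure contains
  \<open>2\<close>.\<close>

lemma fork_chain_not_cut_closure:
  "cut_closure (image_subspace (alexandrov fork_le) fork_closure) E \<noteq> {3..}"
proof
  let ?Y = "image_subspace (alexandrov fork_le) fork_closure"
  let ?U = "upper_bounds ?Y E"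
  assume eq: "cut_closure ?Y E = {3..}"
  show False
  proof (cases "\<exists>n\<in>?U. 3 \<le> n")
    case True
    then obtain n where n: "n \<in> ?U" "3 \<le> n"
      by blast
    have "Suc n \<in> cut_closure ?Y E"
      using n by (simp add: eq)
    then have "fork_le (Suc n) n"
      using n by (simp add: cut_closure_def lower_bounds_def spec_le_fork_image)
    with n show False
      by (simp add: fork_le_def)
  next
    case False
    \<comment> \<open>\<open>?U\<close> is empty if \<open>E\<close> has a point outside the image;
      \<open>2\<close> is a lower bound of \<open>?U\<close> in that case too.\<close>
    then have "?U \<subseteq> {2}"
      by (force simp: upper_bounds_def)
    then have "2 \<in> cut_closure ?Y E"
      by (auto simp: cut_closure_def lower_bounds_def spec_le_fork_image fork_le_def)
    then show False
      by (simp add: eq)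
  qed
qed

lemma directed_in_fork_chain:
  "directed_in (image_subspace (alexandrov fork_le) fork_closure) {3..}"
  unfolding directed_in_def spec_le_fork_image
proof (intro conjI ballI)
  fix x y :: nat assume "x \<in> {3..}" "y \<in> {3..}"
  then show "\<exists>z\<in>{3..}. (2 \<le> x \<and> 2 \<le> z \<and> fork_le x z) \<and> 2 \<le> y \<and> 2 \<le> z \<and> fork_le y z"
    by (intro bexI[of _ "max x y"]) (auto simp: fork_le_def)
qed auto

lemma closedin_fork_chain:
  "closedin (image_subspace (alexandrov fork_le) fork_closure) {3..}"
proof -
  have "closedin (alexandrov fork_le) {3..}"
    by (auto simp: closedin_alexandrov fork_le_def)
  then show ?thesis
    by (auto simp: image_subspace_def range_fork_closure intro: closedin_subset_topspace)
qed

theorem mainTheorem8: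
  shows "(\<exists>(X :: nat topology) p. quasisober X \<and> continuous_map X X p \<and> closure_operator X p \<and>
            \<not> quasisober (image_subspace X p)) \<and>
         (\<exists>(X :: nat topology) p. cut_space X \<and> continuous_map X X p \<and> closure_operator X p \<and>
            \<not> cut_space (image_subspace X p)) \<and>
         (\<exists>(X :: nat topology) p. weakly_sober X \<and> continuous_map X X p \<and> closure_operator X p \<and>
            \<not> weakly_sober (image_subspace X p))"
  \<comment> \<open>The same space and operator witness all three conjuncts.\<close>
  using cut_space_fork sober_like_alexandrov_if_cut_space[OF fork_le_order cut_space_fork]
    closure_operator_fork_closure continuous_map_alexandrov[of fork_le fork_le fork_closure, OF fork_closure_mono]
    not_sober_like_if_not_cut_closure[OF directed_in_fork_chain closedin_fork_chain
      fork_chain_not_cut_closure]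
  by blast

end
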